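(* Let $\hat{A}\in\mathbb{DC}^{n\times n}$ with $r=\operatorname{Rank}(\hat{A})$. Then the dual Moore-Penrose generalized inverse (DMPGI) $\hat{A}^{\dagger}$ exists, and there exists $\hat{U}\in\mathbb{DC}_n^{U}$ such that $$\hat{A}^{\dagger}=\hat{U}\begin{bmatrix}K^*\Sigma_1^{-1}&0\\L^*\Sigma_1^{-1}&0\end{bmatrix}\hat{U}^* =\hat{U}\left(\begin{bmatrix}K_1^*\Sigma_1^{-1}&0\\L_1^*\Sigma_1^{-1}&0\end{bmatrix}+\epsilon\begin{bmatrix}K_2^*\Sigma_1^{-1}&0\\L_2^*\Sigma_1^{-1}&0\end{bmatrix}\right)\hat{U}^*$$ $$=\hat{U}\left(\begin{bmatrix}K_1^*\Sigma_{1s}^{-1}&0\\L_1^*\Sigma_{1s}^{-1}&0\end{bmatrix}+\epsilon\begin{bmatrix}K_2^*\Sigma_{1s}^{-1}-K_1^*\Sigma_{1s}^{-2}\Sigma_{1d}&0\\L_2^*\Sigma_{1s}^{-1}-L_1^*\Sigma_{1s}^{-2}\Sigma_{1d}&0\end{bmatrix}\right)\hat{U}^*,$$ where $K=K_1+\epsilon K_2\in\mathbb{DC}^{r\times r}$ and $L=L_1+\epsilon L_2\in\mathbb{DC}^{r\times(n-r)}$ satisfy $KK^*+LL^*=I_r$, and $\Sigma_1=\Sigma_{1s}+\epsilon\Sigma_{1d}=\operatorname{diag}(\mu_1,\ldots,\mu_r)$ with $\mu_1\ge\cdots\ge\mu_r$ being positive appreciable dual numbers.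
   Context: Dual complex numbers are $\hat a=a_s+\epsilon a_d$ with $a_s,a_d\in\mathbb{C}$, where $\epsilon\ne0$, $\epsilon^2=0$ and $\epsilon$ commutes with scalars; the set of them is $\mathbb{DC}$. A dual number is such an element with $a_s,a_d\in\mathbb{R}$. It is appreciable if $a_s\neq0$ and infinitesimal if $a_s=0$. Dual numbers are totally ordered by: $\hat a\le\hat b$ iff $a_s<b_s$, or $a_s=b_s$ and $a_d\le b_d$; $\hat a$ is positive if $\hat a>0$. $\mathbb{DC}^{m\times n}$ is the set of $m\times n$ dual complex matrices; each is written $\hat A=A_s+\epsilon A_d$ with $A_s,A_d\in\mathbb{C}^{m\times n}$ (its standard and infinitesimal parts), and $\hat A^*=A_s^*+\epsilon A_d^*$. Thus $K_1,K_2\in\mathbb{C}^{r\times r}$ and $L_1,L_2\in\mathbb{C}^{r\times(n-r)}$ are the standard and infinitesimal parts of $K$ and $L$, and $\Sigma_{1s},\Sigma_{1d}$ are those of $\Sigma_1$. $I_r$ is the $r\times r$ identity matrix. $\mathbb{DC}_n^U$ is the set of $n\times n$ dual unitary complex matrices, i.e. $\hat U\in\mathbb{DC}^{n\times n}$ with $\hat U^{-1}=\hat U^*$. Dual SVD and rank: every $\hat A\in\mathbb{DC}^{m\times n}$ can be written $\hat A=\hat P\begin{bmatrix}\Sigma_0&0\\0&0\end{bmatrix}\hat V^*$ with $\hat P\in\mathbb{DC}_m^U$, $\hat V\in\mathbb{DC}_n^U$, $\Sigma_0=\operatorname{diag}(\mu_1,\ldots,\mu_q,\mu_{q+1},\ldots,\mu_t)$,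 where $\mu_1\ge\dots\ge\mu_q$ are positive appreciable dual numbers and $\mu_{q+1}\ge\dots\ge\mu_t$ are positive infinitesimal dual numbers; $\Sigma_0$ is uniquely determined by $\hat A$. The dual rank is $\operatorname{Rank}(\hat A)=t$. The dual Moore-Penrose generalized inverse (DMPGI) $\hat A^\dagger$ of $\hat A\in\mathbb{DC}^{m\times n}$ is the dual matrix $\hat X\in\mathbb{DC}^{n\times m}$ satisfying $\hat A\hat X\hat A=\hat A$, $\hat X\hat A\hat X=\hat X$, $(\hat A\hat X)^*=\hat A\hat X$, $(\hat X\hat A)^*=\hat X\hat A$.
   Formalization: The formal version adds that all r = Rank(Â) nonzero dual singular values of Â are appreciable; without this the claim is false (Â = [ε] has rank 1 but no DMPGI), and the condition is necessary for the DMPGI to exist. *)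

theory Defs
  imports Complex_Main "Jordan_Normal_Form.Schur_Decomposition"
begin

(* The pair Dual a b stands for a + eps b, with eps^2 = 0.  Dual numbers are the type
   real dual, dual complex numbers the type complex dual. *)
datatype 'a dual = Dual (std_part: 'a) (inf_part: 'a)

instantiation dual :: (comm_ring_1) comm_ring_1
begin

definition zero_dual_def: "0 = Dual 0 0"
definition one_dual_def: "1 = Dual 1 0"
definition plus_dual_def: "x + y = Dual (std_part x + std_part y) (inf_part x + inf_part y)"
definition uminus_dual_def: "- x = Dual (- std_part x) (- inf_part x)"
definition minus_dual_def: "x - y = Dual (std_part x - std_part y) (inf_part x - inf_part y)"
definition times_dual_def:
  "x * y = Dual (std_part x * std_part y) (std_part x * inf_part y + inf_part x * std_part y)"

instance
  by standard (auto simp: zero_dual_def one_dual_def plus_dual_def uminus_dual_def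
      minus_dual_def times_dual_def dual.expand algebra_simps)

end

definition dual_eps :: "'a :: comm_ring_1 dual" where
  "dual_eps = Dual 0 1"

instantiation dual :: (linorder) linorder
begin

definition less_eq_dual_def:
  "x \<le> y \<longleftrightarrow> std_part x < std_part y \<or> std_part x = std_part y \<and> inf_part x \<le> inf_part y"
definition less_dual_def:
  "x < y \<longleftrightarrow> x \<le> y \<and> \<not> y \<le> (x :: 'a dual)"

instance
  by standard (auto simp: less_eq_dual_def less_dual_def dual.expand)

end

definition appreciable :: "'a :: zero dual \<Rightarrow> bool" where
  "appreciable x \<longleftrightarrow> std_part x \<noteq> 0"

definition infinitesimal :: "'a :: zero dual \<Rightarrow> bool" where
  "infinitesimal x \<longleftrightarrow> std_part x = 0"

abbreviation of_dual_real :: "real dual \<Rightarrow> complex dual" where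
  "of_dual_real \<equiv> map_dual complex_of_real"

abbreviation std_mat :: "'a dual mat \<Rightarrow> 'a mat" where
  "std_mat \<equiv> map_mat std_part"

abbreviation inf_mat :: "'a dual mat \<Rightarrow> 'a mat" where
  "inf_mat \<equiv> map_mat inf_part"

abbreviation emb_mat :: "'a :: zero mat \<Rightarrow> 'a dual mat" where
  "emb_mat \<equiv> map_mat (\<lambda>a. Dual a 0)"

definition dual_adjoint :: "complex dual mat \<Rightarrow> complex dual mat" where
  "dual_adjoint A =
     emb_mat (mat_adjoint (std_mat A)) + dual_eps \<cdot>\<^sub>m emb_mat (mat_adjoint (inf_mat A))"

(* Two-sided inverse, used both over complex dual (not a field) and over complex. *)
definition mat_inv :: "'a :: semiring_1 mat \<Rightarrow> 'a mat" where
  "mat_inv A = (THE B. B \<in> carrier_mat (dim_col A) (dim_row A) \<and> inverts_mat A B \<and> inverts_mat B A)"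

definition dual_unitary :: "nat \<Rightarrow> complex dual mat \<Rightarrow> bool" where
  "dual_unitary n U \<longleftrightarrow> U \<in> carrier_mat n n \<and>
     inverts_mat U (dual_adjoint U) \<and> inverts_mat (dual_adjoint U) U"

definition dual_diag :: "real dual list \<Rightarrow> complex dual mat" where
  "dual_diag \<mu>s = mat_diag (length \<mu>s) (\<lambda>i. of_dual_real (\<mu>s ! i))"

(* mus is the list mu_1, ..., mu_t of nonzero singular values: first the appreciable ones
   (alphas), then the infinitesimal ones (betas), each group in decreasing order. *)
definition dual_singular_values :: "complex dual mat \<Rightarrow> real dual list \<Rightarrow> bool" where
  "dual_singular_values A \<mu>s \<longleftrightarrow>
     (\<exists>\<alpha>s \<beta>s. \<mu>s = \<alpha>s @ \<beta>s \<and>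
        sorted_wrt (\<ge>) \<alpha>s \<and> (\<forall>\<mu>\<in>set \<alpha>s. \<mu> > 0 \<and> appreciable \<mu>) \<and>
        sorted_wrt (\<ge>) \<beta>s \<and> (\<forall>\<mu>\<in>set \<beta>s. \<mu> > 0 \<and> infinitesimal \<mu>)) \<and>
     (let m = dim_row A; n = dim_col A; t = length \<mu>s in
        t \<le> m \<and> t \<le> n \<and>
        (\<exists>P V. dual_unitary m P \<and> dual_unitary n V \<and>
           A = P * four_block_mat (dual_diag \<mu>s) (0\<^sub>m t (n - t))
                                  (0\<^sub>m (m - t) t) (0\<^sub>m (m - t) (n - t)) * dual_adjoint V))"

definition dual_rank :: "complex dual mat \<Rightarrow> nat" where
  "dual_rank A = (THE t. \<exists>\<mu>s. dual_singular_values A \<mu>s \<and> t = length \<mu>s)"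

definition is_dmpgi :: "complex dual mat \<Rightarrow> complex dual mat \<Rightarrow> bool" where
  "is_dmpgi A X \<longleftrightarrow> X \<in> carrier_mat (dim_col A) (dim_row A) \<and>
     A * X * A = A \<and> X * A * X = X \<and>
     dual_adjoint (A * X) = A * X \<and> dual_adjoint (X * A) = X * A"

definition dmpgi :: "complex dual mat \<Rightarrow> complex dual mat" where
  "dmpgi A = (THE X. is_dmpgi A X)"

(* The block matrix [[M, 0], [N, 0]] with M of size r x r and N of size (n - r) x r. *)
definition left_blocks :: "nat \<Rightarrow> nat \<Rightarrow> 'a :: zero mat \<Rightarrow> 'a mat \<Rightarrow> 'a mat" where
  "left_blocks n r M N = four_block_mat M (0\<^sub>m r (n - r)) N (0\<^sub>m (n - r) (n - r))"

end

theory Submission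
  imports Defs
begin

text \<open>Let \<open>A = P S V\<^sup>*\<close> be a dual singular value decomposition. As all singular values are appreciable,
  \<open>S\<close> has a diagonal Moore-Penrose inverse \<open>T\<close>, and \<open>V T P\<^sup>*\<close> is the one of \<open>A\<close>. With \<open>U = P\<close> and the
  unitary matrix \<open>G = P\<^sup>* V\<close> it equals \<open>U (G T) U\<^sup>*\<close>; the first \<open>r\<close> columns of \<open>G\<close> are \<open>K\<^sup>*\<close> above \<open>L\<^sup>*\<close>,
  and their orthonormality is \<open>K K\<^sup>* + L L\<^sup>* = I\<close>. That \<open>r\<close>, the dual rank, is the number of the given
  singular values follows from the trace of the idempotent \<open>A A\<^sup>\<dagger>\<close>.\<close>

subsection \<open>Dual conjugation and dual inverse\<close>

text \<open>The entrywise counterpart of \<open>dual_adjoint\<close>, which is assembled from the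
  adjoints of the two parts. As a multiplicative involution it carries the usual rules for adjoints
  over to dual matrices.\<close>

definition dual_cnj :: "complex dual \<Rightarrow> complex dual" where
  "dual_cnj = map_dual cnj"

lemma dual_parts [simp]:
  "std_part 0 = 0" "inf_part 0 = 0" "std_part 1 = 1" "inf_part 1 = 0"
  "std_part (x + y) = std_part x + std_part y" "inf_part (x + y) = inf_part x + inf_part y"
  "std_part (x * y) = std_part x * std_part y"
  "inf_part (x * y) = std_part x * inf_part y + inf_part x * std_part y"
  "std_part dual_eps = 0" "inf_part dual_eps = 1"
  for x y :: "'a::comm_ring_1 dual"
  by (simp_all add: zero_dual_def one_dual_def plus_dual_def times_dual_def dual_eps_def)

lemma dual_eq_iff: "x = y \<longleftrightarrow> std_part x = std_part y \<and> inf_part x = inf_part y"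
  by (cases x; cases y) simp

lemma std_part_of_nat [simp]: "std_part (of_nat n :: 'a::comm_ring_1 dual) = of_nat n"
  by (induction n) auto

lemma dual_parts_map [simp]:
  "std_part (map_dual f x) = f (std_part x)" "inf_part (map_dual f x) = f (inf_part x)"
  by (simp_all add: dual.map_sel)

lemma dual_cnj_parts [simp]:
  "std_part (dual_cnj x) = cnj (std_part x)" "inf_part (dual_cnj x) = cnj (inf_part x)"
  by (simp_all add: dual_cnj_def)

lemma dual_cnj_simps [simp]:
  "dual_cnj 0 = 0" "dual_cnj 1 = 1" "dual_cnj (x + y) = dual_cnj x + dual_cnj y"
  "dual_cnj (x * y) = dual_cnj x * dual_cnj y" "dual_cnj (dual_cnj x) = x"
  by (simp_all add: dual_eq_iff)

lemma dual_cnj_sum: "dual_cnj (sum f S) = (\<Sum>i\<in>S. dual_cnj (f i))"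
  by (induction S rule: infinite_finite_induct) auto

text \<open>From (a + eps b)(1/a - eps b/a^2) = 1 for a different from 0. Since division by zero
  gives 0, infinitesimal arguments get the default value 0.\<close>

definition dual_inverse :: "'a::field dual \<Rightarrow> 'a dual" where
  "dual_inverse x = Dual (inverse (std_part x)) (- (inf_part x / (std_part x)\<^sup>2))"

lemma dual_inverse_parts [simp]:
  "std_part (dual_inverse x) = inverse (std_part x)"
  "inf_part (dual_inverse x) = - (inf_part x / (std_part x)\<^sup>2)"
  by (simp_all add: dual_inverse_def)

lemma dual_mult_inverse: "appreciable x \<Longrightarrow> x * dual_inverse x = 1"
  by (simp add: dual_eq_iff appreciable_def power2_eq_square divide_inverse)

lemma of_dual_real_eq_0_iff [simp]: "of_dual_real x = 0 \<longleftrightarrow> x = 0"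
  by (auto simp: dual_eq_iff)

lemma appreciable_of_dual_real [simp]: "appreciable (of_dual_real x) \<longleftrightarrow> appreciable x"
  by (simp add: appreciable_def)

lemma infinitesimal_mult_infinitesimal:
  fixes x y :: "'a::comm_ring_1 dual"
  shows "infinitesimal x \<Longrightarrow> infinitesimal y \<Longrightarrow> x * y = 0"
  by (simp add: infinitesimal_def dual_eq_iff)

text \<open>Dual numbers do not form a field, but a nonzero von Neumann regular element is a unit:
  an appreciable \<open>x\<close> can be cancelled, and an infinitesimal \<open>x\<close> has square
  0, so that \<open>x * y * x\<close> would vanish.\<close>

lemma regular_dual_mult_eq_1:
  fixes x y :: "'a::field dual"
  assumes "x * y * x = x" "x \<noteq> 0"
  shows "x * y = 1"
proof (cases "appreciable x")
  case True
  have "x * y = x * y * (x * dual_inverse x)"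
    by (simp only: dual_mult_inverse [OF True] mult_1_right)
  also have "\<dots> = x * y * x * dual_inverse x"
    by (simp only: mult.assoc)
  also have "\<dots> = 1"
    using assms(1) dual_mult_inverse [OF True] by simp
  finally show ?thesis .
next
  case False
  then have "infinitesimal x"
    by (simp add: appreciable_def infinitesimal_def)
  then have "x * x = 0"
    by (simp add: infinitesimal_mult_infinitesimal)
  moreover have "x * y * x = x * x * y"
    by (simp only: mult_ac)
  ultimately show ?thesis
    using assms by simp
qed

subsection \<open>Matrices\<close>

text \<open>Dimension equations as side conditions let long products be reassociated to the right by
  rewriting.\<close>

lemma mat_mult_assoc:
  fixes A B C :: "'a::semiring_0 mat"
  shows "dim_col A = dim_row B \<Longrightarrow> dim_col B = dim_row C \<Longrightarrow> A * B * C = A * (B * C)"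
  by (rule assoc_mult_mat) auto

text \<open>Fits right-nested products, where the pair \<open>Q\<close>, \<open>P\<close> stands in
  front of a remaining factor \<open>B\<close>.\<close>

lemma mat_cancel_left:
  fixes P Q B :: "'a::semiring_1 mat"
  shows "Q * P = 1\<^sub>m n \<Longrightarrow> dim_col Q = dim_row P \<Longrightarrow> dim_col P = dim_row B \<Longrightarrow>
    dim_row B = n \<Longrightarrow> Q * (P * B) = B"
  by (simp flip: mat_mult_assoc)

text \<open>Interchange of the two summations. The trace is written as a sum over the diagonal, and
  the factors may be rectangular.\<close>

lemma trace_mult_commute:
  fixes A B :: "'a::comm_semiring_0 mat"
  assumes "A \<in> carrier_mat m n" "B \<in> carrier_mat n m"
  shows "(\<Sum>i<m. (A * B) $$ (i, i)) = (\<Sum>i<n. (B * A) $$ (i, i))"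
proof -
  have "(\<Sum>i<m. (A * B) $$ (i, i)) = (\<Sum>i<m. \<Sum>j<n. A $$ (i, j) * B $$ (j, i))"
    using assms by (auto simp: scalar_prod_def lessThan_atLeast0 intro!: sum.cong)
  also have "\<dots> = (\<Sum>j<n. \<Sum>i<m. B $$ (j, i) * A $$ (i, j))"
    by (subst sum.swap) (simp add: mult.commute)
  also have "\<dots> = (\<Sum>i<n. (B * A) $$ (i, i))"
    using assms by (auto simp: scalar_prod_def lessThan_atLeast0 intro!: sum.cong)
  finally show ?thesis .
qed

text \<open>The definite description is met by at most one matrix, since a left inverse
  \<open>C\<close> and a right inverse \<open>B\<close> agree: C = C (A B) = (C A) B = B.\<close>

lemma mat_inv_eqI:
  fixes A B :: "'a::semiring_1 mat"
  assumes A: "A \<in> carrier_mat n n" and B: "B \<in> carrier_mat n n"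
    and AB: "A * B = 1\<^sub>m n" and BA: "B * A = 1\<^sub>m n"
  shows "mat_inv A = B"
  unfolding mat_inv_def
proof (rule the_equality)
  show "B \<in> carrier_mat (dim_col A) (dim_row A) \<and> inverts_mat A B \<and> inverts_mat B A"
    using assms by (auto simp: inverts_mat_def)
next
  fix C assume "C \<in> carrier_mat (dim_col A) (dim_row A) \<and> inverts_mat A C \<and> inverts_mat C A"
  then have C: "C \<in> carrier_mat n n" and "C * A = 1\<^sub>m n"
    using A by (auto simp: inverts_mat_def)
  then have "B = C * A * B"
    using B by simp
  also have "\<dots> = C * (A * B)"
    using A B C by (simp add: mat_mult_assoc)
  also have "\<dots> = C"
    using AB C by simp
  finally show "C = B" ..
qed

lemma mat_inv_mat_diag:
  fixes f g :: "nat \<Rightarrow> 'a::comm_semiring_1"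
  assumes "\<And>i. i < n \<Longrightarrow> f i * g i = 1"
  shows "mat_inv (mat_diag n f) = mat_diag n g"
proof (rule mat_inv_eqI)
  have "mat_diag n (\<lambda>i. f i * g i) = 1\<^sub>m n"
    using assms by (intro eq_matI) (auto simp: mat_diag_def)
  then show "mat_diag n f * mat_diag n g = 1\<^sub>m n" "mat_diag n g * mat_diag n f = 1\<^sub>m n"
    by (simp_all add: mult.commute)
qed simp_all

section \<open>Adjoints and dual unitary matrices\<close>

lemma mat_adjoint_dim [simp]:
  "dim_row (mat_adjoint A) = dim_col A" "dim_col (mat_adjoint A) = dim_row A"
  by (simp_all add: mat_adjoint_def)

lemma mat_adjoint_index [simp]:
  "i < dim_col A \<Longrightarrow> j < dim_row A \<Longrightarrow> mat_adjoint A $$ (i, j) = conjugate (A $$ (j, i))"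
  by (simp add: mat_adjoint_def mat_of_rows_def)

lemma dual_adjoint_dim [simp]:
  "dim_row (dual_adjoint A) = dim_col A" "dim_col (dual_adjoint A) = dim_row A"
  by (simp_all add: dual_adjoint_def)

lemma dual_adjoint_carrier [simp]:
  "dual_adjoint A \<in> carrier_mat m n \<longleftrightarrow> A \<in> carrier_mat n m"
  by (metis carrier_matD carrier_matI dual_adjoint_dim)

text \<open>Multiplication by \<open>dual_eps\<close> moves the embedded second adjoint into the
  infinitesimal slot, so both parts are conjugated and transposed together.\<close>

lemma dual_adjoint_index [simp]:
  "i < dim_col A \<Longrightarrow> j < dim_row A \<Longrightarrow> dual_adjoint A $$ (i, j) = dual_cnj (A $$ (j, i))"
  by (simp add: dual_adjoint_def dual_eq_iff)

lemma dual_adjoint_adjoint [simp]: "dual_adjoint (dual_adjoint A) = A"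
  by (rule eq_matI) auto

lemma dual_adjoint_mult:
  "dim_col A = dim_row B \<Longrightarrow> dual_adjoint (A * B) = dual_adjoint B * dual_adjoint A"
  by (rule eq_matI) (auto simp: scalar_prod_def dual_cnj_sum mult.commute)

lemma dual_unitaryD:
  assumes "dual_unitary n U"
  shows "U \<in> carrier_mat n n" "U * dual_adjoint U = 1\<^sub>m n" "dual_adjoint U * U = 1\<^sub>m n"
  using assms by (auto simp: dual_unitary_def inverts_mat_def)

subsection \<open>Rectangular diagonal matrices\<close>

text \<open>The middle factor of a singular value decomposition. Describing it by a function instead
  of four blocks makes its products and adjoints computable entrywise.\<close>

definition pad_diag :: "nat \<Rightarrow> nat \<Rightarrow> nat \<Rightarrow> (nat \<Rightarrow> 'a::zero) \<Rightarrow> 'a mat" where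
  "pad_diag m n t f = mat m n (\<lambda>(i, j). if i = j \<and> i < t then f i else 0)"

lemma pad_diag_carrier [simp]: "pad_diag m n t f \<in> carrier_mat m n"
  and pad_diag_dim [simp]: "dim_row (pad_diag m n t f) = m" "dim_col (pad_diag m n t f) = n"
  and pad_diag_index [simp]: "i < m \<Longrightarrow> j < n \<Longrightarrow>
    pad_diag m n t f $$ (i, j) = (if i = j \<and> i < t then f i else 0)"
  by (simp_all add: pad_diag_def)

lemma four_block_mat_diag_eq_pad_diag:
  assumes "t \<le> m" "t \<le> n"
  shows "four_block_mat (mat_diag t f) (0\<^sub>m t (n - t)) (0\<^sub>m (m - t) t) (0\<^sub>m (m - t) (n - t)) =
    pad_diag m n t f"
  using assms by (intro eq_matI) (auto simp: mat_diag_def)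

lemma mult_pad_diag_index:
  fixes A :: "'a::semiring_0 mat"
  assumes "A \<in> carrier_mat k m" "t \<le> m" "i < k" "j < n"
  shows "(A * pad_diag m n t f) $$ (i, j) = (if j < t then A $$ (i, j) * f j else 0)"
proof -
  have "(A * pad_diag m n t f) $$ (i, j) =
      (\<Sum>l<m. A $$ (i, l) * (if l = j \<and> l < t then f l else 0))"
    using assms by (auto simp: scalar_prod_def lessThan_atLeast0 intro!: sum.cong)
  also have "\<dots> = (\<Sum>l<m. if l = j then (if j < t then A $$ (i, j) * f j else 0) else 0)"
    by (rule sum.cong) auto
  also have "\<dots> = (if j < t then A $$ (i, j) * f j else 0)"
    using assms by auto
  finally show ?thesis .
qed

lemma pad_diag_mult_index:
  fixes A :: "'a::semiring_0 mat"
  assumes "A \<in> carrier_mat n k" "t \<le> n" "i < m" "j < k"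
  shows "(pad_diag m n t f * A) $$ (i, j) = (if i < t then f i * A $$ (i, j) else 0)"
proof -
  have "(pad_diag m n t f * A) $$ (i, j) =
      (\<Sum>l<n. (if i = l \<and> i < t then f i else 0) * A $$ (l, j))"
    using assms by (auto simp: scalar_prod_def lessThan_atLeast0 intro!: sum.cong)
  also have "\<dots> = (\<Sum>l<n. if l = i then (if i < t then f i * A $$ (i, j) else 0) else 0)"
    by (rule sum.cong) auto
  also have "\<dots> = (if i < t then f i * A $$ (i, j) else 0)"
    using assms by auto
  finally show ?thesis .
qed

lemma pad_diag_mult_pad_diag:
  fixes f g :: "nat \<Rightarrow> 'a::semiring_0"
  assumes "t \<le> n"
  shows "pad_diag m n t f * pad_diag n k t g = pad_diag m k t (\<lambda>i. f i * g i)"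
proof (rule eq_matI)
  fix i j assume ij: "i < dim_row (pad_diag m k t (\<lambda>i. f i * g i))"
    "j < dim_col (pad_diag m k t (\<lambda>i. f i * g i))"
  then show "(pad_diag m n t f * pad_diag n k t g) $$ (i, j) =
      pad_diag m k t (\<lambda>i. f i * g i) $$ (i, j)"
    using assms by (subst mult_pad_diag_index [where k = m]) auto
qed auto

lemma dual_adjoint_pad_diag:
  "dual_adjoint (pad_diag m n t f) = pad_diag n m t (\<lambda>i. dual_cnj (f i))"
  by (rule eq_matI) auto

lemma pad_diag_cong:
  "(\<And>i. i < t \<Longrightarrow> f i = g i) \<Longrightarrow> pad_diag m n t f = pad_diag m n t g"
  by (rule eq_matI) auto

subsection \<open>The dual rank and the Moore-Penrose inverse\<close>

lemma dual_singular_valuesE: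
  assumes "dual_singular_values A \<mu>s" "A \<in> carrier_mat m n"
  obtains P V where "dual_unitary m P" "dual_unitary n V" "length \<mu>s \<le> m" "length \<mu>s \<le> n"
    "A = P * pad_diag m n (length \<mu>s) (\<lambda>i. of_dual_real (\<mu>s ! i)) * dual_adjoint V"
  using assms that unfolding dual_singular_values_def Let_def dual_diag_def
  by (auto simp: four_block_mat_diag_eq_pad_diag)

lemma dual_singular_values_pos:
  "dual_singular_values A \<mu>s \<Longrightarrow> \<mu> \<in> set \<mu>s \<Longrightarrow> \<mu> > 0"
  by (auto simp: dual_singular_values_def)

text \<open>The definition orders the appreciable and the infinitesimal values separately; here the
  second group is empty.\<close>

lemma dual_singular_values_sorted:
  assumes "dual_singular_values A \<mu>s" "\<forall>\<mu>\<in>set \<mu>s. appreciable \<mu>"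
  shows "sorted_wrt (\<ge>) \<mu>s"
proof -
  obtain \<alpha>s \<beta>s where *: "\<mu>s = \<alpha>s @ \<beta>s" "sorted_wrt (\<ge>) \<alpha>s" "\<forall>\<mu>\<in>set \<beta>s. infinitesimal \<mu>"
    using assms(1) by (auto simp: dual_singular_values_def)
  then have "set \<beta>s = {}"
    using assms(2) by (auto simp: appreciable_def infinitesimal_def)
  then show ?thesis
    using * by simp
qed

text \<open>With \<open>A = P S V\<^sup>*\<close> and \<open>Y = V\<^sup>* X P\<close> we get \<open>S Y S = S\<close>, which forces \<open>\<mu>\<^sub>i Y\<^sub>i\<^sub>i = 1\<close>; in
  particular no \<open>\<mu>\<^sub>i\<close> is infinitesimal. Since the left-hand side does not depend on the decomposition,
  this is what makes the length of \<open>\<mu>s\<close> unique.\<close>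

lemma trace_mult_inner_inverse:
  assumes A: "A \<in> carrier_mat m n" and X: "X \<in> carrier_mat n m" and AXA: "A * X * A = A"
    and sv: "dual_singular_values A \<mu>s"
  shows "(\<Sum>i<m. (A * X) $$ (i, i)) = of_nat (length \<mu>s)"
proof -
  define t where "t = length \<mu>s"
  define s where "s = (\<lambda>i. of_dual_real (\<mu>s ! i))"
  define S where "S = pad_diag m n t s"
  obtain P V where "dual_unitary m P" "dual_unitary n V" and t: "t \<le> m" "t \<le> n"
    and A_eq: "A = P * S * dual_adjoint V"
    unfolding S_def s_def t_def by (rule dual_singular_valuesE [OF sv A])
  note P = dual_unitaryD [OF \<open>dual_unitary m P\<close>] and V = dual_unitaryD [OF \<open>dual_unitary n V\<close>]
  define Y where "Y = dual_adjoint V * (X * P)"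
  have S: "S \<in> carrier_mat m n"
    by (simp add: S_def)
  have Y: "Y \<in> carrier_mat n m"
    using X P V by (auto simp: Y_def intro!: carrier_matI)
  have dims [simp]: "dim_row A = m" "dim_col A = n" "dim_row X = n" "dim_col X = m"
    "dim_row P = m" "dim_col P = m" "dim_row V = n" "dim_col V = n" "dim_row S = m" "dim_col S = n"
    using A X P(1) V(1) S by auto
  \<comment> \<open>Once a product is nested to the right, this removes each inner pair coming from
    the unitarity of \<open>P\<close>.\<close>
  have cancel: "dual_adjoint P * (P * B) = B" if "dim_row B = m" for B
    using that by (intro mat_cancel_left [OF P(3)]) auto
  have S_eq: "dual_adjoint P * A * V = S"
    using S V(3) by (simp add: A_eq mat_mult_assoc cancel)
  have "S * Y * S = dual_adjoint P * (A * X * A) * V"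
    using S V(3) by (simp add: A_eq Y_def mat_mult_assoc cancel)
  then have SYS: "S * Y * S = S"
    by (simp add: AXA S_eq)
  have diag: "(S * Y) $$ (i, i) = (if i < t then 1 else 0)" if "i < m" for i
  proof (cases "i < t")
    case True
    have i: "(S * Y) $$ (i, i) = s i * Y $$ (i, i)"
      using True Y t that unfolding S_def by (subst pad_diag_mult_index [where k = m]) auto
    have "(S * Y * S) $$ (i, i) = (S * Y) $$ (i, i) * s i"
      using True Y t that unfolding S_def
      by (subst mult_pad_diag_index [where k = m]) auto
    then have "s i * Y $$ (i, i) * s i = s i"
      using True t that unfolding SYS i by (simp add: S_def)
    moreover have "\<mu>s ! i > 0"
      using True by (intro dual_singular_values_pos [OF sv]) (simp add: t_def)
    then have "s i \<noteq> 0"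
      by (auto simp: s_def)
    ultimately have "s i * Y $$ (i, i) = 1"
      by (rule regular_dual_mult_eq_1)
    then show ?thesis
      using True i by simp
  next
    case False
    then show ?thesis
      using Y t that unfolding S_def by (subst pad_diag_mult_index [where k = m]) auto
  qed
  \<comment> \<open>Cyclicity moves the leading \<open>P\<close> to the end, which turns A X into
    \<open>S * Y\<close>.\<close>
  have "(\<Sum>i<m. (A * X) $$ (i, i)) = (\<Sum>i<m. (P * (S * (dual_adjoint V * X))) $$ (i, i))"
    by (simp add: A_eq mat_mult_assoc)
  also have "\<dots> = (\<Sum>i<m. (S * (dual_adjoint V * X) * P) $$ (i, i))"
    by (rule trace_mult_commute) auto
  also have "\<dots> = (\<Sum>i<m. (S * Y) $$ (i, i))"
    by (simp add: Y_def mat_mult_assoc)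
  also have "\<dots> = (\<Sum>i<m. if i < t then 1 else 0)"
    by (intro sum.cong) (auto simp: diag)
  also have "\<dots> = of_nat (card ({..<m} \<inter> {i. i < t}))"
    by (simp add: sum.If_cases)
  also have "{..<m} \<inter> {i. i < t} = {..<t}"
    using t by auto
  finally show ?thesis
    by (simp add: t_def)
qed

text \<open>The definite description in \<open>dual_rank\<close> requires all lists of singular
  values of \<open>A\<close> to have one length. Each length equals the trace of the same matrix
  \<open>A * X\<close>.\<close>

lemma dual_rank_eqI:
  assumes A: "A \<in> carrier_mat m n" and X: "X \<in> carrier_mat n m" and AXA: "A * X * A = A"
    and sv: "dual_singular_values A \<mu>s"
  shows "dual_rank A = length \<mu>s"
  unfolding dual_rank_def
proof (rule the_equality)
  show "\<exists>\<nu>s. dual_singular_values A \<nu>s \<and> length \<mu>s = length \<nu>s"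
    using sv by blast
next
  fix t assume "\<exists>\<nu>s. dual_singular_values A \<nu>s \<and> t = length \<nu>s"
  then obtain \<nu>s where \<nu>s: "dual_singular_values A \<nu>s" "t = length \<nu>s"
    by blast
  have "(of_nat (length \<nu>s) :: complex dual) = of_nat (length \<mu>s)"
    using trace_mult_inner_inverse [OF A X AXA] \<nu>s(1) sv by metis
  \<comment> \<open>Passing to standard parts reduces the equation to complex numbers, where
    \<open>of_nat\<close> is injective.\<close>
  then have "std_part (of_nat (length \<nu>s) :: complex dual) = std_part (of_nat (length \<mu>s))"
    by (rule arg_cong)
  then show "t = length \<mu>s"
    by (simp add: \<nu>s)
qed

text \<open>Penrose's argument: the self-adjoint products satisfy A X = A Y and X A = Y A, whence X
  = X A X = X A Y = Y A Y = Y.\<close>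

lemma is_dmpgi_unique:
  assumes X: "is_dmpgi A X" and Y: "is_dmpgi A Y"
  shows "X = Y"
proof -
  have dims [simp]: "dim_row X = dim_col A" "dim_col X = dim_row A"
    "dim_row Y = dim_col A" "dim_col Y = dim_row A"
    using X Y by (auto simp: is_dmpgi_def)
  have X1: "A * X * A = A" "X * A * X = X" "dual_adjoint (A * X) = A * X" "dual_adjoint (X * A) = X * A"
    using X by (auto simp: is_dmpgi_def)
  have Y1: "A * Y * A = A" "Y * A * Y = Y" "dual_adjoint (A * Y) = A * Y" "dual_adjoint (Y * A) = Y * A"
    using Y by (auto simp: is_dmpgi_def)
  have "A * X = A * Y * A * X"
    by (simp only: Y1)
  \<comment> \<open>Both factors are self-adjoint; taking the adjoint outside reverses them, and A X
    A Y collapses to A Y.\<close>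
  also have "\<dots> = dual_adjoint (A * Y) * dual_adjoint (A * X)"
    by (simp only: X1(3,4) Y1(3,4)) (simp add: mat_mult_assoc)
  also have "\<dots> = dual_adjoint (A * X * A * Y)"
    by (subst dual_adjoint_mult [symmetric]) (simp_all add: mat_mult_assoc)
  finally have AX: "A * X = A * Y"
    by (simp add: X1 Y1)
  have "X * A = X * (A * Y * A)"
    by (simp only: Y1)
  also have "\<dots> = dual_adjoint (X * A) * dual_adjoint (Y * A)"
    by (simp only: X1(3,4) Y1(3,4)) (simp add: mat_mult_assoc)
  also have "\<dots> = dual_adjoint (Y * (A * X * A))"
    by (subst dual_adjoint_mult [symmetric]) (simp_all add: mat_mult_assoc)
  finally have XA: "X * A = Y * A"
    by (simp add: X1 Y1)
  have "X = X * (A * X)"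
    using X1(2) by (simp add: mat_mult_assoc)
  also have "\<dots> = X * A * Y"
    by (simp add: AX mat_mult_assoc)
  also have "\<dots> = Y"
    by (simp add: XA Y1)
  finally show ?thesis .
qed

text \<open>The inner unitary factors cancel, so the two products become P (S T) P* and V (T S) V*.
  The Penrose equations for \<open>S\<close> and \<open>T\<close> then carry over.\<close>

lemma is_dmpgi_unitary:
  assumes T: "is_dmpgi S T" and S: "S \<in> carrier_mat m n"
    and "dual_unitary m P" "dual_unitary n V"
  shows "is_dmpgi (P * S * dual_adjoint V) (V * T * dual_adjoint P)"
proof -
  note P = dual_unitaryD [OF assms(3)] and V = dual_unitaryD [OF assms(4)]
  have T1: "T \<in> carrier_mat n m" "S * T * S = S" "T * S * T = T"
    "dual_adjoint (S * T) = S * T" "dual_adjoint (T * S) = T * S"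
    using T S by (auto simp: is_dmpgi_def)
  have dims [simp]: "dim_row T = n" "dim_col T = m"
    "dim_row P = m" "dim_col P = m" "dim_row V = n" "dim_col V = n" "dim_row S = m" "dim_col S = n"
    using T1 P(1) V(1) S by auto
  have cancelP: "dual_adjoint P * (P * B) = B" if "dim_row B = m" for B
    using that by (intro mat_cancel_left [OF P(3)]) auto
  have cancelV: "dual_adjoint V * (V * B) = B" if "dim_row B = n" for B
    using that by (intro mat_cancel_left [OF V(3)]) auto
  let ?A = "P * S * dual_adjoint V" and ?X = "V * T * dual_adjoint P"
  have AX: "?A * ?X = P * (S * T) * dual_adjoint P"
    by (simp add: mat_mult_assoc cancelV)
  have XA: "?X * ?A = V * (T * S) * dual_adjoint V"
    by (simp add: mat_mult_assoc cancelP)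
  have "?A * ?X * ?A = P * (S * T * S) * dual_adjoint V"
    unfolding AX by (simp add: mat_mult_assoc cancelP)
  moreover have "?X * ?A * ?X = V * (T * S * T) * dual_adjoint P"
    unfolding XA by (simp add: mat_mult_assoc cancelV)
  moreover have "dual_adjoint (?A * ?X) = ?A * ?X"
    unfolding AX using T1(4) by (simp add: dual_adjoint_mult mat_mult_assoc)
  moreover have "dual_adjoint (?X * ?A) = ?X * ?A"
    unfolding XA using T1(5) by (simp add: dual_adjoint_mult mat_mult_assoc)
  ultimately show ?thesis
    unfolding is_dmpgi_def by (auto simp: T1(2,3) intro!: carrier_matI)
qed

text \<open>Both products are diagonal with \<open>t\<close> ones followed by zeros, hence
  self-adjoint idempotents.\<close>

lemma is_dmpgi_pad_diag:
  assumes fg: "\<And>i. i < t \<Longrightarrow> f i * g i = 1" and t: "t \<le> m" "t \<le> n"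
  shows "is_dmpgi (pad_diag m n t f) (pad_diag n m t g)"
proof -
  have gf: "g i * f i = 1" if "i < t" for i
    using fg [OF that] by (simp add: mult.commute)
  have ST: "pad_diag m n t f * pad_diag n m t g = pad_diag m m t (\<lambda>_. 1)"
    using t by (simp add: pad_diag_mult_pad_diag fg cong: pad_diag_cong)
  have TS: "pad_diag n m t g * pad_diag m n t f = pad_diag n n t (\<lambda>_. 1)"
    using t by (simp add: pad_diag_mult_pad_diag gf cong: pad_diag_cong)
  show ?thesis
    using t by (simp add: is_dmpgi_def ST TS pad_diag_mult_pad_diag dual_adjoint_pad_diag)
qed

lemma dmpgi_eqI: "is_dmpgi A X \<Longrightarrow> dmpgi A = X"
  unfolding dmpgi_def by (blast intro: is_dmpgi_unique)

subsection \<open>Block form\<close>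

lemma mat_diag_dims [simp]: "dim_row (mat_diag n f) = n" "dim_col (mat_diag n f) = n"
  by (simp_all add: mat_diag_def)

lemma mult_mat_diag:
  fixes A :: "'a::semiring_0 mat"
  shows "dim_col A = n \<Longrightarrow>
    A * mat_diag n f = mat (dim_row A) n (\<lambda>(i, j). A $$ (i, j) * f j)"
  by (rule mat_diag_mult_right) auto

lemma left_blocks_index:
  assumes "r \<le> n" "M \<in> carrier_mat r r" "N \<in> carrier_mat (n - r) r" "i < n" "j < n"
  shows "left_blocks n r M N $$ (i, j) =
    (if j < r then if i < r then M $$ (i, j) else N $$ (i - r, j) else 0)"
  using assms by (auto simp: left_blocks_def)

lemma left_blocks_carrier:
  "r \<le> n \<Longrightarrow> M \<in> carrier_mat r r \<Longrightarrow> N \<in> carrier_mat (n - r) r \<Longrightarrow>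
    left_blocks n r M N \<in> carrier_mat n n"
  by (auto simp: left_blocks_def intro!: carrier_matI)

text \<open>Right multiplication scales the first \<open>r\<close> columns by \<open>g\<close> and
  annihilates the others, which produces the zero blocks on the right. The shift
  \<open>i + r\<close> addresses the lower rows of \<open>G\<close>.\<close>

lemma mult_pad_diag_eq_left_blocks:
  fixes G :: "'a::semiring_1 mat"
  assumes G: "G \<in> carrier_mat n n" and r: "r \<le> n"
  shows "G * pad_diag n n r g =
    left_blocks n r (mat r r (\<lambda>(i, j). G $$ (i, j)) * mat_diag r g)
      (mat (n - r) r (\<lambda>(i, j). G $$ (i + r, j)) * mat_diag r g)"
    (is "_ = left_blocks n r ?M ?N")
proof (rule eq_matI)
  have MN: "?M \<in> carrier_mat r r" "?N \<in> carrier_mat (n - r) r"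
    by (auto intro!: mult_carrier_mat)
  note carrier = left_blocks_carrier [OF r MN]
  fix i j assume "i < dim_row (left_blocks n r ?M ?N)" "j < dim_col (left_blocks n r ?M ?N)"
  then have ij: "i < n" "j < n"
    using carrier by auto
  show "(G * pad_diag n n r g) $$ (i, j) = left_blocks n r ?M ?N $$ (i, j)"
    unfolding left_blocks_index [OF r MN ij] mult_pad_diag_index [OF G r ij]
    using ij r by (auto simp: mult_mat_diag)
next
  show "dim_row (G * pad_diag n n r g) = dim_row (left_blocks n r ?M ?N)"
    "dim_col (G * pad_diag n n r g) = dim_col (left_blocks n r ?M ?N)"
    using G r by (auto simp: left_blocks_def)
qed

text \<open>The block matrix is linear in the adjoints of \<open>K\<close> and \<open>L\<close>, so
  these split into parts while the dual diagonal factor stays whole.\<close>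

lemma left_blocks_adjoint_diag_parts:
  assumes r: "r \<le> n" and K: "K \<in> carrier_mat r r" and L: "L \<in> carrier_mat r (n - r)"
  shows "left_blocks n r (dual_adjoint K * mat_diag r g) (dual_adjoint L * mat_diag r g) =
    left_blocks n r (emb_mat (mat_adjoint (std_mat K)) * mat_diag r g)
      (emb_mat (mat_adjoint (std_mat L)) * mat_diag r g) +
    dual_eps \<cdot>\<^sub>m left_blocks n r (emb_mat (mat_adjoint (inf_mat K)) * mat_diag r g)
      (emb_mat (mat_adjoint (inf_mat L)) * mat_diag r g)"
    (is "?X = ?Y + dual_eps \<cdot>\<^sub>m ?Z")
proof -
  have dims: "dim_row K = r" "dim_col K = r" "dim_row L = r" "dim_col L = n - r"
    using K L by auto
  show ?thesis
    using r by (intro eq_matI)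
      (auto simp: left_blocks_def mult_mat_diag dims dual_eq_iff algebra_simps)
qed

text \<open>Here the diagonal factor is split as well: \<open>g i\<close> has parts 1/a and -b/a^2,
  and the product rule for infinitesimal parts yields the correction term with the squared inverse
  of \<open>S\<close>.\<close>

lemma left_blocks_adjoint_diag_inverse:
  assumes r: "r \<le> n" and K: "K \<in> carrier_mat r r" and L: "L \<in> carrier_mat r (n - r)"
    and a: "\<And>i. i < r \<Longrightarrow> a i \<noteq> 0"
    and S: "S = mat_diag r a" and D: "D = mat_diag r b"
    and g: "g = (\<lambda>i. dual_inverse (Dual (a i) (b i)))"
  shows "left_blocks n r (dual_adjoint K * mat_diag r g) (dual_adjoint L * mat_diag r g) =
    emb_mat (left_blocks n r (mat_adjoint (std_mat K) * mat_inv S)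
      (mat_adjoint (std_mat L) * mat_inv S)) +
    dual_eps \<cdot>\<^sub>m emb_mat (left_blocks n r
      (mat_adjoint (inf_mat K) * mat_inv S - mat_adjoint (std_mat K) * mat_inv S ^\<^sub>m 2 * D)
      (mat_adjoint (inf_mat L) * mat_inv S - mat_adjoint (std_mat L) * mat_inv S ^\<^sub>m 2 * D))"
proof -
  have inv: "mat_inv S = mat_diag r (\<lambda>i. inverse (a i))"
    unfolding S by (rule mat_inv_mat_diag) (simp add: a)
  have sq: "mat_inv S ^\<^sub>m 2 = mat_diag r (\<lambda>i. inverse (a i) * inverse (a i))"
    by (simp add: inv numeral_2_eq_2)
  have g_parts: "std_part (g i) = inverse (a i)"
    "inf_part (g i) = - (inverse (a i) * inverse (a i) * b i)" for i
    by (simp_all add: g power2_eq_square divide_inverse)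
  have dims: "dim_row K = r" "dim_col K = r" "dim_row L = r" "dim_col L = n - r"
    using K L by auto
  show ?thesis
    unfolding sq D unfolding inv using r
    by (intro eq_matI)
      (auto simp: left_blocks_def mult_mat_diag dims g_parts dual_eq_iff algebra_simps)
qed

text \<open>Orthonormality of the first \<open>r\<close> columns of \<open>G\<close>: each inner
  product runs over all \<open>n\<close> rows and is split at row \<open>r\<close>.\<close>

lemma left_block_isometry:
  assumes G: "G \<in> carrier_mat n n" and GG: "dual_adjoint G * G = 1\<^sub>m n" and r: "r \<le> n"
  shows "dual_adjoint (mat r r (\<lambda>(i, j). G $$ (i, j))) * mat r r (\<lambda>(i, j). G $$ (i, j)) +
    dual_adjoint (mat (n - r) r (\<lambda>(i, j). G $$ (i + r, j))) *
      mat (n - r) r (\<lambda>(i, j). G $$ (i + r, j)) = 1\<^sub>m r"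
    (is "?T = _")
proof (rule eq_matI)
  fix i j assume "i < dim_row (1\<^sub>m r :: complex dual mat)" "j < dim_col (1\<^sub>m r :: complex dual mat)"
  then have ij: "i < r" "j < r"
    by auto
  let ?f = "\<lambda>k. dual_cnj (G $$ (k, i)) * G $$ (k, j)"
  have "?T $$ (i, j) = (\<Sum>k=0..<r. ?f k) + (\<Sum>k=0..<n - r. ?f (k + r))"
    using ij by (simp add: scalar_prod_def)
  also have "(\<Sum>k=0..<n - r. ?f (k + r)) = (\<Sum>k=r..<n. ?f k)"
    using r sum.shift_bounds_nat_ivl [of ?f 0 r "n - r"] by simp
  also have "(\<Sum>k=0..<r. ?f k) + (\<Sum>k=r..<n. ?f k) = (\<Sum>k=0..<n. ?f k)"
    using r by (intro sum.atLeastLessThan_concat) auto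
  also have "\<dots> = (dual_adjoint G * G) $$ (i, j)"
    using ij r G by (simp add: scalar_prod_def)
  also have "\<dots> = 1\<^sub>m r $$ (i, j)"
    using ij r by (simp add: GG)
  finally show "?T $$ (i, j) = 1\<^sub>m r $$ (i, j)" .
qed auto

section \<open>The block form of the Moore-Penrose inverse of a square dual matrix\<close>

theorem corollary4p3:
  fixes A :: "complex dual mat" and n r :: nat and \<mu>s :: "real dual list"
  assumes "A \<in> carrier_mat n n"
    and "r = dual_rank A"
    and "dual_singular_values A \<mu>s"
    and "\<forall>\<mu>\<in>set \<mu>s. appreciable \<mu>"
  shows "(\<exists>!X. is_dmpgi A X) \<and>
    (\<exists>U K L \<Sigma>1.
       dual_unitary n U \<and>
       K \<in> carrier_mat r r \<and> L \<in> carrier_mat r (n - r) \<and>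
       K * dual_adjoint K + L * dual_adjoint L = 1\<^sub>m r \<and>
       length \<mu>s = r \<and> sorted_wrt (\<ge>) \<mu>s \<and> (\<forall>\<mu>\<in>set \<mu>s. \<mu> > 0 \<and> appreciable \<mu>) \<and>
       \<Sigma>1 = dual_diag \<mu>s \<and>
       (let K1 = std_mat K; K2 = inf_mat K; L1 = std_mat L; L2 = inf_mat L;
            S = std_mat \<Sigma>1; D = inf_mat \<Sigma>1 in
          dmpgi A =
            U * left_blocks n r (dual_adjoint K * mat_inv \<Sigma>1) (dual_adjoint L * mat_inv \<Sigma>1)
              * dual_adjoint U \<and>
          dmpgi A =
            U * (left_blocks n r (emb_mat (mat_adjoint K1) * mat_inv \<Sigma>1)
                                 (emb_mat (mat_adjoint L1) * mat_inv \<Sigma>1)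
                 + dual_eps \<cdot>\<^sub>m
                 left_blocks n r (emb_mat (mat_adjoint K2) * mat_inv \<Sigma>1)
                                 (emb_mat (mat_adjoint L2) * mat_inv \<Sigma>1))
              * dual_adjoint U \<and>
          dmpgi A =
            U * (emb_mat (left_blocks n r (mat_adjoint K1 * mat_inv S)
                                          (mat_adjoint L1 * mat_inv S))
                 + dual_eps \<cdot>\<^sub>m emb_mat (left_blocks n r
                     (mat_adjoint K2 * mat_inv S - mat_adjoint K1 * mat_inv S ^\<^sub>m 2 * D)
                     (mat_adjoint L2 * mat_inv S - mat_adjoint L1 * mat_inv S ^\<^sub>m 2 * D)))
              * dual_adjoint U))"
proof -
  note A = assms(1) and sv = assms(3) and app = assms(4)
  define t where "t = length \<mu>s"
  define s where "s = (\<lambda>i. of_dual_real (\<mu>s ! i))"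
  \<comment> \<open>The diagonal entries of the inverse of \<open>\<Sigma>1\<close>.\<close>
  define g where "g = (\<lambda>i. dual_inverse (s i))"
  obtain P V where P_unitary: "dual_unitary n P" and V_unitary: "dual_unitary n V" and t: "t \<le> n"
    and A_eq: "A = P * pad_diag n n t s * dual_adjoint V"
    unfolding s_def t_def by (rule dual_singular_valuesE [OF sv A])
  note P = dual_unitaryD [OF P_unitary] and V = dual_unitaryD [OF V_unitary]
  have app_s: "appreciable (s i)" if "i < t" for i
    using app that by (simp add: s_def t_def)
  then have sg: "s i * g i = 1" if "i < t" for i
    using that by (simp add: g_def dual_mult_inverse)
  have X: "is_dmpgi A (V * pad_diag n n t g * dual_adjoint P)" (is "is_dmpgi A ?X")
    unfolding A_eq using sg t
    by (intro is_dmpgi_unitary [OF is_dmpgi_pad_diag _ P_unitary V_unitary]) auto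
  \<comment> \<open>The inverse just constructed serves as the inner inverse from which the rank is
    read off.\<close>
  then have "dual_rank A = t"
    using A dual_rank_eqI [where X = ?X, OF A _ _ sv] by (simp add: is_dmpgi_def t_def [symmetric])
  then have rt: "r = t"
    using assms(2) by simp
  define G where "G = dual_adjoint P * V"
  have G: "G \<in> carrier_mat n n"
    using P(1) V(1) by (simp add: G_def)
  \<comment> \<open>Since V = P G, the left factor \<open>V\<close> can be traded for
    \<open>P\<close>, so that \<open>P\<close> and its adjoint enclose the whole expression.\<close>
  have PG: "P * (G * B) = V * B" if "dim_row B = n" for B
    using P V that by (simp add: G_def mat_mult_assoc mat_cancel_left [OF P(2)])
  have GG: "dual_adjoint G * G = 1\<^sub>m n"
    using P V by (simp add: G_def dual_adjoint_mult mat_mult_assoc mat_cancel_left [OF P(2)])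
  \<comment> \<open>Defined as adjoints of blocks of \<open>G\<close>, so that the adjoints of
    \<open>K\<close> and \<open>L\<close> are these blocks themselves.\<close>
  define K where "K = dual_adjoint (mat r r (\<lambda>(i, j). G $$ (i, j)))"
  define L where "L = dual_adjoint (mat (n - r) r (\<lambda>(i, j). G $$ (i + r, j)))"
  have K: "K \<in> carrier_mat r r" and L: "L \<in> carrier_mat r (n - r)"
    by (simp_all add: K_def L_def)
  have KL: "K * dual_adjoint K + L * dual_adjoint L = 1\<^sub>m r"
    unfolding K_def L_def dual_adjoint_adjoint using G GG t rt by (intro left_block_isometry) auto
  have inv: "mat_inv (dual_diag \<mu>s) = mat_diag r g"
    unfolding dual_diag_def rt t_def
    by (rule mat_inv_mat_diag) (use sg in \<open>simp add: s_def t_def\<close>)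
  have "dmpgi A = ?X"
    by (rule dmpgi_eqI [OF X])
  also have "\<dots> = P * (G * pad_diag n n r g) * dual_adjoint P"
    using P V G by (simp add: PG rt)
  also have "G * pad_diag n n r g =
      left_blocks n r (dual_adjoint K * mat_diag r g) (dual_adjoint L * mat_diag r g)"
    using mult_pad_diag_eq_left_blocks [OF G] t rt by (simp add: K_def L_def)
  finally have form: "dmpgi A = P * left_blocks n r (dual_adjoint K * mat_diag r g)
      (dual_adjoint L * mat_diag r g) * dual_adjoint P" .
  have S: "std_mat (dual_diag \<mu>s) = mat_diag r (\<lambda>i. std_part (s i))"
    and D: "inf_mat (dual_diag \<mu>s) = mat_diag r (\<lambda>i. inf_part (s i))"
    by (auto simp: dual_diag_def mat_diag_def rt t_def s_def)
  have "r \<le> n"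
    using t rt by simp
  note form2 = left_blocks_adjoint_diag_parts [OF \<open>r \<le> n\<close> K L]
  have form3: "left_blocks n r (dual_adjoint K * mat_diag r g) (dual_adjoint L * mat_diag r g) =
      emb_mat (left_blocks n r (mat_adjoint (std_mat K) * mat_inv (std_mat (dual_diag \<mu>s)))
        (mat_adjoint (std_mat L) * mat_inv (std_mat (dual_diag \<mu>s)))) +
      dual_eps \<cdot>\<^sub>m emb_mat (left_blocks n r
        (mat_adjoint (inf_mat K) * mat_inv (std_mat (dual_diag \<mu>s)) -
          mat_adjoint (std_mat K) * mat_inv (std_mat (dual_diag \<mu>s)) ^\<^sub>m 2 * inf_mat (dual_diag \<mu>s))
        (mat_adjoint (inf_mat L) * mat_inv (std_mat (dual_diag \<mu>s)) -
          mat_adjoint (std_mat L) * mat_inv (std_mat (dual_diag \<mu>s)) ^\<^sub>m 2 * inf_mat (dual_diag \<mu>s)))"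
    \<comment> \<open>Appreciability of the singular values says that the standard parts on the
      diagonal are nonzero.\<close>
    by (rule left_blocks_adjoint_diag_inverse [OF \<open>r \<le> n\<close> K L _ S D])
      (use app_s rt in \<open>auto simp: appreciable_def g_def\<close>)
  have unique: "\<exists>!X. is_dmpgi A X"
    using X is_dmpgi_unique by blast
  have len: "length \<mu>s = r"
    by (simp add: rt t_def)
  have pos: "\<forall>\<mu>\<in>set \<mu>s. \<mu> > 0 \<and> appreciable \<mu>"
    using dual_singular_values_pos [OF sv] app by blast
  \<comment> \<open>The witness for \<open>U\<close> is \<open>P\<close>. The three displayed
    formulas are \<open>form\<close> and its rewritings by \<open>form2\<close> and
    \<open>form3\<close>, with \<open>inv\<close> read backwards in the first two to restore the
    inverse of \<open>\<Sigma>1\<close>.\<close>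
  show ?thesis
    unfolding Let_def
    by (intro conjI exI [of _ P] exI [of _ K] exI [of _ L] exI [of _ "dual_diag \<mu>s"])
      (rule unique P_unitary K L KL len dual_singular_values_sorted [OF sv app] pos refl
        form [folded inv] form [unfolded form2, folded inv] form [unfolded form3])+
qed

end
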